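(* Let $\mathcal{P}$ be an increasing sequence of positive real numbers such that (P1) $\mathcal{P}\cap[0,1)=\varnothing$ and (P2) the series $\sum_{p\in\mathcal{P}}\frac{1}{p^{\sigma}}$ has abscissa of convergence equal to $1$. Let $(X_p)_{p\in\mathcal{P}}$ be i.i.d. random variables with $\mathbb{P}(X_p=1)=\mathbb{P}(X_p=-1)=1/2$, and let $F(\sigma)=\sum_{p\in\mathcal{P}}\frac{X_p}{p^{\sigma}}$. If $\sum_{p\in\mathcal{P}}\frac{1}{p}=\infty$, then for each fixed $\delta>0$, with positive probability $F(\sigma)$ has no zeros in the interval $[1/2+\delta,\infty)$.
   Context: The elements of $\mathcal{P}$ are listed as $p_1<p_2<\cdots$, and sums over $p\in\mathcal{P}$ are taken in this increasing order. The abscissa of convergence of a Dirichlet series $\sum_{p\in\mathcal{P}}a_p p^{-\sigma}$ is the smallest number $\sigma_c$ such that the series converges for all real $\sigma>\sigma_c$. Under (P1)-(P2) the random series $F(\sigma)$ has almost surely abscissa of convergence $1/2$, so almost surely $F(\sigma)$ is defined for all real $\sigma>1/2$. *)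

theory Defs
  imports "HOL-Probability.Probability"
begin

text \<open>The set \<open>\<P>\<close> is represented by its increasing enumeration \<open>p 0 < p 1 < \<dots>\<close>, and a
  family indexed by \<open>\<P>\<close> by the corresponding family indexed by \<open>nat\<close>. The constants
  \<^const>\<open>summable\<close> and \<^const>\<open>suminf\<close> refer to limits of partial sums in this order, so
  conditional convergence is covered.\<close>

definition dirichlet_converges :: "(nat \<Rightarrow> real) \<Rightarrow> (nat \<Rightarrow> real) \<Rightarrow> real \<Rightarrow> bool" where
  "dirichlet_converges p a \<sigma> \<longleftrightarrow> summable (\<lambda>n. a n / p n powr \<sigma>)"

definition dirichlet_series :: "(nat \<Rightarrow> real) \<Rightarrow> (nat \<Rightarrow> real) \<Rightarrow> real \<Rightarrow> real" where
  "dirichlet_series p a \<sigma> = (\<Sum>n. a n / p n powr \<sigma>)"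

definition has_abscissa :: "(nat \<Rightarrow> real) \<Rightarrow> (nat \<Rightarrow> real) \<Rightarrow> real \<Rightarrow> bool" where
  "has_abscissa p a c \<longleftrightarrow>
     (\<forall>\<sigma>>c. dirichlet_converges p a \<sigma>) \<and>
     (\<forall>c'. (\<forall>\<sigma>>c'. dirichlet_converges p a \<sigma>) \<longrightarrow> c \<le> c')"

end

theory Submission imports Defs begin

text \<open>Put \<open>a = 1/2 + \<delta>\<close>. A maximal inequality of Kolmogorov type shows that the series converges
  almost surely at \<open>a\<close> and that, for large \<open>N\<close>, with positive probability all partial sums of
  the tail \<open>n \<ge> N\<close> at \<open>a\<close> are at most half of \<open>p 0\<close> to the power \<open>-a\<close>. By Abel summation
  the tail at \<open>\<sigma> \<ge> a\<close> is then smaller than the first term \<open>p 0\<close> to the power \<open>-\<sigma>\<close>. The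
  event that all the signs with \<open>n < N\<close> are \<open>1\<close> is independent of the tail and has positive
  probability, and on both events the series is positive on \<open>[a,\<infinity>)\<close>. The event of the theorem is
  measurable because the series is continuous on \<open>[a,\<infinity>)\<close>, so that its nonvanishing can be tested on
  the points \<open>a + r\<close> with \<open>r\<close> rational.\<close>

section \<open>Summation by parts\<close>

text \<open>After summation by parts every partial sum of \<open>b\<close> is multiplied by a
  nonnegative decrement of \<open>g\<close>. The decrements telescope to \<open>g 0 - g m\<close>,
  and the boundary term supplies the missing \<open>e * g m\<close>.\<close>

lemma abel_summation_bound:
  fixes b g :: "nat \<Rightarrow> real"
  assumes "\<And>j. j \<le> m \<Longrightarrow> \<bar>\<Sum>i<j. b i\<bar> \<le> e" and "antimono g" and "\<And>i. 0 \<le> g i"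
  shows "\<bar>\<Sum>i<m. b i * g i\<bar> \<le> e * g 0"
proof -
  let ?B = "\<lambda>j. \<Sum>i<j. b i"
  have parts: "(\<Sum>i<m. b i * g i) = ?B m * g m + (\<Sum>i<m. ?B (Suc i) * (g i - g (Suc i)))"
    by (induction m) (simp_all add: algebra_simps)
  have "\<bar>?B (Suc i) * (g i - g (Suc i))\<bar> \<le> e * (g i - g (Suc i))" if "i < m" for i
    using assms(1)[of "Suc i"] antimonoD[OF assms(2), of i "Suc i"] that
    by (auto simp: abs_mult simp del: sum.lessThan_Suc intro!: mult_right_mono)
  then have "\<bar>\<Sum>i<m. ?B (Suc i) * (g i - g (Suc i))\<bar> \<le> (\<Sum>i<m. e * (g i - g (Suc i)))"
    by (intro order_trans[OF sum_abs sum_mono]) auto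
  also have "\<dots> = e * (g 0 - g m)"
    using sum_lessThan_telescope'[of g m] by (simp add: sum_distrib_left[symmetric])
  finally have "\<bar>\<Sum>i<m. ?B (Suc i) * (g i - g (Suc i))\<bar> \<le> e * (g 0 - g m)" .
  moreover have "\<bar>?B m * g m\<bar> \<le> e * g m"
    using assms(1)[of m] assms(3)[of m] by (auto simp: abs_mult intro!: mult_right_mono)
  ultimately show ?thesis
    unfolding parts by (simp add: algebra_simps)
qed

section \<open>Independence, the maximal inequality and almost sure convergence\<close>

text \<open>Grouping by disjoint index sets preserves independence. The blocks may be infinite, so
  one of them can carry an event about a whole tail.\<close>

lemma (in prob_space) prob_indep_restrict:
  assumes "indep_vars M' X I" and "A \<inter> B = {}" "A \<subseteq> I" "B \<subseteq> I"
    and [measurable]: "Measurable.pred (PiM A M') P" "Measurable.pred (PiM B M') Q"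
  shows "prob {\<omega> \<in> space M. P (restrict (\<lambda>i. X i \<omega>) A) \<and> Q (restrict (\<lambda>i. X i \<omega>) B)} =
    prob {\<omega> \<in> space M. P (restrict (\<lambda>i. X i \<omega>) A)} * prob {\<omega> \<in> space M. Q (restrict (\<lambda>i. X i \<omega>) B)}"
proof -
  let ?A = "\<lambda>\<omega>. restrict (\<lambda>i. X i \<omega>) A" and ?B = "\<lambda>\<omega>. restrict (\<lambda>i. X i \<omega>) B"
  have ind: "indep_var (PiM A M') ?A (PiM B M') ?B"
    by (rule indep_var_restrict[OF assms(1-4)])
  have "prob ((\<lambda>\<omega>. (?A \<omega>, ?B \<omega>)) -` ({x \<in> space (PiM A M'). P x} \<times> {x \<in> space (PiM B M'). Q x}) \<inter> space M) =
    prob (?A -` {x \<in> space (PiM A M'). P x} \<inter> space M) * prob (?B -` {x \<in> space (PiM B M'). Q x} \<inter> space M)"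
    by (rule indep_varD[OF ind]) auto
  moreover have "?A \<omega> \<in> space (PiM A M')" "?B \<omega> \<in> space (PiM B M')" if "\<omega> \<in> space M" for \<omega>
    using measurable_space[OF indep_var_rv1[OF ind] that] measurable_space[OF indep_var_rv2[OF ind] that]
    by simp_all
  ultimately show ?thesis
    by (simp add: vimage_def Int_def conj_commute cong: conj_cong rev_conj_cong)
qed


text \<open>The starting value \<open>s\<close> makes the induction on the number of steps possible: conditioning on
  the first sign replaces \<open>s\<close> by \<open>s \<plusminus> c N\<close>, and the mean of the two squares is
  \<open>s\<^sup>2 + (c N)\<^sup>2\<close>.\<close>
lemma (in prob_space) rademacher_maximal_finite:
  fixes X :: "nat \<Rightarrow> 'a \<Rightarrow> real" and c :: "nat \<Rightarrow> real"
  assumes ind: "indep_vars (\<lambda>_. borel) X UNIV"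
    and plus: "\<And>n. prob {\<omega> \<in> space M. X n \<omega> = 1} = 1 / 2"
    and minus: "\<And>n. prob {\<omega> \<in> space M. X n \<omega> = - 1} = 1 / 2"
    and "t > 0"
  shows "prob {\<omega> \<in> space M. \<exists>j\<le>k. t \<le> \<bar>s + (\<Sum>i<j. c (N + i) * X (N + i) \<omega>)\<bar>}
    \<le> (s\<^sup>2 + (\<Sum>i<k. (c (N + i))\<^sup>2)) / t\<^sup>2"
proof (induction k arbitrary: N s)
  case 0
  show ?case
  proof (cases "t \<le> \<bar>s\<bar>")
    case True
    then have "t\<^sup>2 \<le> s\<^sup>2"
      using \<open>t > 0\<close> by (simp add: abs_le_square_iff[symmetric])
    then have "1 \<le> s\<^sup>2 / t\<^sup>2"
      using \<open>t > 0\<close> by simp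
    then show ?thesis
      using True by (simp add: prob_space)
  qed simp
next
  case (Suc k)
  have [measurable]: "X n \<in> borel_measurable M" for n
    using ind by (simp add: indep_vars_def)
  show ?case
  \<comment> \<open>If the start already reaches \<open>t\<close>, the claimed bound is at least 1.
    Otherwise \<open>j = 0\<close> is excluded, so a crossing happens after the first sign has been
    used.\<close>
  proof (cases "t \<le> \<bar>s\<bar>")
    case True
    then have "t\<^sup>2 \<le> s\<^sup>2"
      using \<open>t > 0\<close> by (simp add: abs_le_square_iff[symmetric])
    then have "1 \<le> (s\<^sup>2 + (\<Sum>i<Suc k. (c (N + i))\<^sup>2)) / t\<^sup>2"
      using \<open>t > 0\<close> by (simp add: sum_nonneg add_increasing2 del: sum.lessThan_Suc)
    then show ?thesis
      using prob_le_1 by (rule order_trans[rotated])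
  next
    case False
    define E where "E u = {\<omega> \<in> space M. \<exists>j\<le>k. t \<le> \<bar>u + (\<Sum>i<j. c (Suc N + i) * X (Suc N + i) \<omega>)\<bar>}" for u
    have [measurable]: "E u \<in> events" for u
      unfolding E_def by measurable
    \<comment> \<open>\<open>E u\<close> depends only on the signs from \<open>Suc N\<close> on,
      hence is independent of \<open>X N\<close>; writing both events through
      \<open>restrict\<close> brings them into the form of
      \<open>prob_indep_restrict\<close>.\<close>
    have half: "prob {\<omega> \<in> space M. X N \<omega> = r \<and> \<omega> \<in> E u} = 1 / 2 * prob (E u)" if "r = 1 \<or> r = -1" for r u
    proof -
      let ?Q = "\<lambda>f. \<exists>j\<le>k. t \<le> \<bar>u + (\<Sum>i<j. c (Suc N + i) * f (Suc N + i))\<bar>"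
      have "Measurable.pred (PiM {Suc N..} (\<lambda>_. borel)) ?Q"
        by measurable
      then have "prob {\<omega> \<in> space M. (restrict (\<lambda>i. X i \<omega>) {N}) N = r \<and> ?Q (restrict (\<lambda>i. X i \<omega>) {Suc N..})} =
        prob {\<omega> \<in> space M. (restrict (\<lambda>i. X i \<omega>) {N}) N = r} *
        prob {\<omega> \<in> space M. ?Q (restrict (\<lambda>i. X i \<omega>) {Suc N..})}"
        by (intro prob_indep_restrict[OF ind]) auto
      then show ?thesis
        using that plus[of N] minus[of N] by (auto simp: E_def conj_commute cong: conj_cong)
    qed
    \<comment> \<open>The two values exhaust the probability but perhaps not the space, so the split
      by the first sign holds only almost everywhere.\<close>
    have "AE \<omega> in M. X N \<omega> = 1 \<or> X N \<omega> = - 1"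
    proof -
      have "prob ({\<omega> \<in> space M. X N \<omega> = 1} \<union> {\<omega> \<in> space M. X N \<omega> = - 1}) = 1"
        by (subst finite_measure_Union) (auto simp: plus minus)
      then show ?thesis
        by (rule AE_prob_1[THEN AE_mp]) auto
    qed
    then have "AE \<omega> in M. (\<exists>j\<le>Suc k. t \<le> \<bar>s + (\<Sum>i<j. c (N + i) * X (N + i) \<omega>)\<bar>) \<longrightarrow>
        X N \<omega> = 1 \<and> \<omega> \<in> E (s + c N) \<or> X N \<omega> = - 1 \<and> \<omega> \<in> E (s - c N)"
      using AE_space
    proof eventually_elim
      case (elim \<omega>)
      show ?case
      proof (intro impI, elim exE conjE)
        fix j assume j: "j \<le> Suc k" "t \<le> \<bar>s + (\<Sum>i<j. c (N + i) * X (N + i) \<omega>)\<bar>"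
        with False obtain l where l: "j = Suc l" "l \<le> k"
          by (cases j) auto
        have "t \<le> \<bar>(s + c N * X N \<omega>) + (\<Sum>i<l. c (Suc N + i) * X (Suc N + i) \<omega>)\<bar>"
          using j(2) unfolding l(1) sum.lessThan_Suc_shift by (simp add: algebra_simps)
        with elim l(2) show "X N \<omega> = 1 \<and> \<omega> \<in> E (s + c N) \<or> X N \<omega> = - 1 \<and> \<omega> \<in> E (s - c N)"
          unfolding E_def by auto
      qed
    qed
    then have "prob {\<omega> \<in> space M. \<exists>j\<le>Suc k. t \<le> \<bar>s + (\<Sum>i<j. c (N + i) * X (N + i) \<omega>)\<bar>} \<le>
        prob ({\<omega> \<in> space M. X N \<omega> = 1 \<and> \<omega> \<in> E (s + c N)} \<union> {\<omega> \<in> space M. X N \<omega> = - 1 \<and> \<omega> \<in> E (s - c N)})"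
      by (intro finite_measure_mono_AE) auto
    also have "\<dots> \<le> prob {\<omega> \<in> space M. X N \<omega> = 1 \<and> \<omega> \<in> E (s + c N)} + prob {\<omega> \<in> space M. X N \<omega> = - 1 \<and> \<omega> \<in> E (s - c N)}"
      by (intro measure_Un_le) auto
    also have "\<dots> = 1 / 2 * prob (E (s + c N)) + 1 / 2 * prob (E (s - c N))"
      by (subst (1 2) half) auto
    \<comment> \<open>The induction hypothesis is used at \<open>Suc N\<close> with the two shifted
      starts; their cross terms \<open>2 * s * c N\<close> then cancel.\<close>
    also have "\<dots> \<le> 1 / 2 * (((s + c N)\<^sup>2 + (\<Sum>i<k. (c (Suc N + i))\<^sup>2)) / t\<^sup>2) +
        1 / 2 * (((s - c N)\<^sup>2 + (\<Sum>i<k. (c (Suc N + i))\<^sup>2)) / t\<^sup>2)"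
      unfolding E_def by (intro add_mono mult_left_mono Suc.IH) auto
    also have "\<dots> = (s\<^sup>2 + (\<Sum>i<Suc k. (c (N + i))\<^sup>2)) / t\<^sup>2"
      unfolding sum.lessThan_Suc_shift by (simp add: power2_sum power2_diff add_divide_distrib diff_divide_distrib algebra_simps)
    finally show ?thesis .
  qed
qed

text \<open>The finite-horizon events increase with \<open>k\<close> and their bounds stay below the
  one with the full series, so continuity from below gives the infinite horizon.\<close>

lemma (in prob_space) rademacher_maximal:
  fixes X :: "nat \<Rightarrow> 'a \<Rightarrow> real" and c :: "nat \<Rightarrow> real"
  assumes ind: "indep_vars (\<lambda>_. borel) X UNIV"
    and plus: "\<And>n. prob {\<omega> \<in> space M. X n \<omega> = 1} = 1 / 2"
    and minus: "\<And>n. prob {\<omega> \<in> space M. X n \<omega> = - 1} = 1 / 2"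
    and "t > 0" and summ: "summable (\<lambda>i. (c i)\<^sup>2)"
  shows "prob {\<omega> \<in> space M. \<exists>j. t \<le> \<bar>\<Sum>i<j. c (N + i) * X (N + i) \<omega>\<bar>}
    \<le> (\<Sum>i. (c (N + i))\<^sup>2) / t\<^sup>2"
proof -
  have [measurable]: "X n \<in> borel_measurable M" for n
    using ind by (simp add: indep_vars_def)
  \<comment> \<open>The summand \<open>0\<close> is the starting value \<open>s = 0\<close> of the
    finite version.\<close>
  define E where "E k = {\<omega> \<in> space M. \<exists>j\<le>k. t \<le> \<bar>0 + (\<Sum>i<j. c (N + i) * X (N + i) \<omega>)\<bar>}" for k :: nat
  have "summable (\<lambda>i. (c (N + i))\<^sup>2)"
    using summ summable_iff_shift[of "\<lambda>i. (c i)\<^sup>2" N] by (simp add: add.commute)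
  then have "prob (E k) \<le> (\<Sum>i. (c (N + i))\<^sup>2) / t\<^sup>2" for k
    unfolding E_def
    by (intro order_trans[OF rademacher_maximal_finite[OF ind plus minus \<open>t > 0\<close>]] divide_right_mono)
      (auto intro!: sum_le_suminf)
  moreover have "(\<lambda>k. prob (E k)) \<longlonglongrightarrow> prob (\<Union>k. E k)"
    by (intro finite_Lim_measure_incseq) (auto simp: E_def incseq_def intro: order_trans)
  ultimately have "prob (\<Union>k. E k) \<le> (\<Sum>i. (c (N + i))\<^sup>2) / t\<^sup>2"
    by (intro LIMSEQ_le_const2) auto
  moreover have "(\<Union>k. E k) = {\<omega> \<in> space M. \<exists>j. t \<le> \<bar>\<Sum>i<j. c (N + i) * X (N + i) \<omega>\<bar>}"
    by (auto simp: E_def)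
  ultimately show ?thesis
    by simp
qed


text \<open>By the maximal inequality, the probability that the tail from \<open>N\<close> has a
  partial sum reaching \<open>t\<close> tends to 0 as \<open>N\<close> grows. Hence almost surely
  some tail stays below \<open>t\<close>, and letting \<open>t\<close> run through a sequence
  tending to 0 gives the Cauchy criterion.\<close>

lemma (in prob_space) rademacher_AE_summable:
  fixes X :: "nat \<Rightarrow> 'a \<Rightarrow> real" and c :: "nat \<Rightarrow> real"
  assumes ind: "indep_vars (\<lambda>_. borel) X UNIV"
    and plus: "\<And>n. prob {\<omega> \<in> space M. X n \<omega> = 1} = 1 / 2"
    and minus: "\<And>n. prob {\<omega> \<in> space M. X n \<omega> = - 1} = 1 / 2"
    and summ: "summable (\<lambda>i. (c i)\<^sup>2)"
  shows "AE \<omega> in M. summable (\<lambda>i. c i * X i \<omega>)"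
proof -
  have [measurable]: "X n \<in> borel_measurable M" for n
    using ind by (simp add: indep_vars_def)
  have small: "AE \<omega> in M. \<exists>N. \<forall>j. \<bar>\<Sum>i<j. c (N + i) * X (N + i) \<omega>\<bar> < t" if "t > 0" for t
  proof -
    let ?B = "{\<omega> \<in> space M. \<forall>N. \<exists>j. t \<le> \<bar>\<Sum>i<j. c (N + i) * X (N + i) \<omega>\<bar>}"
    have "prob ?B \<le> 0 + e" if "e > 0" for e
    proof -
      obtain N where "norm (\<Sum>i. (c (i + N))\<^sup>2) < e * t\<^sup>2"
        using suminf_exist_split[OF _ summ, of "e * t\<^sup>2"] \<open>e > 0\<close> \<open>t > 0\<close> by auto
      then have N: "(\<Sum>i. (c (N + i))\<^sup>2) / t\<^sup>2 < e"
        using \<open>t > 0\<close> by (simp add: add.commute field_simps)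
      have "prob ?B \<le> prob {\<omega> \<in> space M. \<exists>j. t \<le> \<bar>\<Sum>i<j. c (N + i) * X (N + i) \<omega>\<bar>}"
        by (intro finite_measure_mono) auto
      also have "\<dots> \<le> (\<Sum>i. (c (N + i))\<^sup>2) / t\<^sup>2"
        by (rule rademacher_maximal[OF ind plus minus \<open>t > 0\<close> summ])
      finally show ?thesis
        using N by simp
    qed
    then have "prob ?B \<le> 0"
      by (rule field_le_epsilon)
    then have "prob ?B = 0"
      by (simp add: measure_le_0_iff)
    then have "AE \<omega> in M. \<omega> \<notin> ?B"
      by (intro AE_not_in) (auto simp: null_sets_def emeasure_eq_measure)
    then show ?thesis
      using AE_space by eventually_elim (auto simp: not_le)
  qed
  \<comment> \<open>Countably many thresholds suffice, which lets the quantifier move inside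
    \<open>AE\<close>.\<close>
  have "AE \<omega> in M. \<forall>k. \<exists>N. \<forall>j. \<bar>\<Sum>i<j. c (N + i) * X (N + i) \<omega>\<bar> < inverse (real (Suc k))"
    unfolding AE_all_countable by (intro allI small) simp
  then show ?thesis
  proof eventually_elim
    case (elim \<omega>)
    let ?f = "\<lambda>i. c i * X i \<omega>"
    show ?case
      unfolding summable_Cauchy
    proof (intro allI impI)
      fix e :: real assume "e > 0"
      then obtain k where k: "inverse (real (Suc k)) < e / 2"
        using reals_Archimedean[of "e / 2"] by auto
      obtain N where N: "\<bar>\<Sum>i<j. ?f (N + i)\<bar> < inverse (real (Suc k))" for j
        using elim by blast
      have block: "sum ?f {N..<n} = (\<Sum>i<n - N. ?f (N + i))" for n
        by (simp add: sum.atLeastLessThan_shift_0[of ?f N n] lessThan_atLeast0)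
      have "norm (sum ?f {m..<n}) < e" if "m \<ge> N" for m n
      proof (cases "m \<le> n")
        case True
        \<comment> \<open>The control is only on blocks starting at \<open>N\<close>; a general
          block is a difference of two of these, each below \<open>e / 2\<close>.\<close>
        then have "sum ?f {m..<n} = sum ?f {N..<n} - sum ?f {N..<m}"
          using that by (simp add: sum.atLeastLessThan_concat[of N m n ?f, symmetric])
        then show ?thesis
          using N[of "n - N"] N[of "m - N"] k unfolding block real_norm_def by linarith
      qed (use \<open>e > 0\<close> in simp)
      then show "\<exists>N. \<forall>m\<ge>N. \<forall>n. norm (sum ?f {m..<n}) < e"
        by blast
    qed
  qed
qed

section \<open>Dirichlet series to the right of a point of convergence\<close>

text \<open>Each term at \<sigma> is the term at \<open>a\<close> times
  \<open>p (N + i) powr (a - \<sigma>)\<close>, a weight that decreases in \<open>i\<close> because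
  \<sigma> is at least \<open>a\<close>; Abel summation applies.\<close>

lemma dirichlet_block_bound:
  fixes p x :: "nat \<Rightarrow> real"
  assumes "strict_mono p" "\<And>n. 0 < p n" "a \<le> \<sigma>"
    and "\<And>j. j \<le> m \<Longrightarrow> \<bar>\<Sum>i<j. x (N + i) / p (N + i) powr a\<bar> \<le> e"
  shows "\<bar>\<Sum>i<m. x (N + i) / p (N + i) powr \<sigma>\<bar> \<le> e * p N powr (a - \<sigma>)"
proof -
  have "antimono (\<lambda>i. p (N + i) powr (a - \<sigma>))"
    using assms(1-3) by (intro antimonoI powr_mono2') (simp_all add: strict_mono_less_eq)
  then have "\<bar>\<Sum>i<m. x (N + i) / p (N + i) powr a * p (N + i) powr (a - \<sigma>)\<bar> \<le> e * p (N + 0) powr (a - \<sigma>)"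
    using assms(4) by (intro abel_summation_bound) auto
  moreover have "x i / p i powr a * p i powr (a - \<sigma>) = x i / p i powr \<sigma>" for i
    using assms(2)[of i] by (simp add: powr_diff)
  ultimately show ?thesis
    by simp
qed

text \<open>As \<open>p m\<close> is at least 1, the factor \<open>p m powr (a - \<sigma>)\<close>
  of the block bound is at most 1, so the Cauchy estimate at \<open>a\<close> serves all \<sigma> at
  once.\<close>

lemma dirichlet_uniformly_convergent:
  assumes p: "strict_mono p" "\<And>n. 1 \<le> p n" and conv: "dirichlet_converges p x a"
  shows "uniformly_convergent_on {a..} (\<lambda>n \<sigma>. \<Sum>i<n. x i / p i powr \<sigma>)"
  unfolding uniformly_convergent_eq_Cauchy
proof (rule uniformly_Cauchy_onI')
  fix e :: real assume "e > 0"
  then obtain N where N: "\<And>m n. m \<ge> N \<Longrightarrow> \<bar>\<Sum>i=m..<n. x i / p i powr a\<bar> < e / 2"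
    using conv unfolding dirichlet_converges_def summable_Cauchy
    by (metis half_gt_zero real_norm_def)
  have block: "sum f {m..<n} = (\<Sum>i<n - m. f (m + i))" for f :: "nat \<Rightarrow> real" and m n
    by (simp add: sum.atLeastLessThan_shift_0[of f m n] lessThan_atLeast0)
  have "dist (\<Sum>i<m. x i / p i powr \<sigma>) (\<Sum>i<n. x i / p i powr \<sigma>) < e"
    if "a \<le> \<sigma>" "N \<le> m" "m < n" for \<sigma> m n
  proof -
    have "\<bar>\<Sum>i<n - m. x (m + i) / p (m + i) powr \<sigma>\<bar> \<le> e / 2 * p m powr (a - \<sigma>)"
    proof (intro dirichlet_block_bound)
      fix j
      show "\<bar>\<Sum>i<j. x (m + i) / p (m + i) powr a\<bar> \<le> e / 2"
        using N[OF \<open>N \<le> m\<close>, of "m + j"] by (simp add: block)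
    qed (use p \<open>a \<le> \<sigma>\<close> in \<open>auto intro: less_le_trans[OF zero_less_one]\<close>)
    also have "\<dots> \<le> e / 2 * 1"
      using p(2)[of m] \<open>a \<le> \<sigma>\<close> \<open>e > 0\<close> powr_mono[of "a - \<sigma>" 0 "p m"] by (intro mult_left_mono) auto
    also have "\<dots> < e"
      using \<open>e > 0\<close> by simp
    finally have "\<bar>\<Sum>i=m..<n. x i / p i powr \<sigma>\<bar> < e"
      by (simp add: block)
    moreover have "(\<Sum>i<n. x i / p i powr \<sigma>) = (\<Sum>i<m. x i / p i powr \<sigma>) + (\<Sum>i=m..<n. x i / p i powr \<sigma>)"
      using \<open>m < n\<close> by (simp add: lessThan_atLeast0 sum.atLeastLessThan_concat)
    ultimately show ?thesis
      by (simp add: dist_real_def)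
  qed
  then show "\<exists>N. \<forall>\<sigma>\<in>{a..}. \<forall>m\<ge>N. \<forall>n>m. dist (\<Sum>i<m. x i / p i powr \<sigma>) (\<Sum>i<n. x i / p i powr \<sigma>) < e"
    by (meson atLeast_iff)
qed

lemma dirichlet_converges_mono:
  assumes "strict_mono p" "\<And>n. 1 \<le> p n" "dirichlet_converges p x a" "a \<le> \<sigma>"
  shows "dirichlet_converges p x \<sigma>"
  unfolding dirichlet_converges_def summable_iff_convergent
  by (rule uniformly_convergent_imp_convergent[OF dirichlet_uniformly_convergent[OF assms(1-3)]])
    (simp add: assms(4))

lemma continuous_on_dirichlet_series:
  assumes "strict_mono p" "\<And>n. 1 \<le> p n" "dirichlet_converges p x a"
  shows "continuous_on {a..} (dirichlet_series p x)"
proof -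
  have "uniform_limit {a..} (\<lambda>n \<sigma>. \<Sum>i<n. x i / p i powr \<sigma>) (\<lambda>\<sigma>. \<Sum>i. x i / p i powr \<sigma>) sequentially"
    using dirichlet_uniformly_convergent[OF assms]
    unfolding uniformly_convergent_uniform_limit_iff by (simp add: suminf_eq_lim)
  moreover have "p i \<noteq> 0" for i
    using assms(2)[of i] by linarith
  ultimately show ?thesis
    unfolding dirichlet_series_def[abs_def]
    by (intro uniform_limit_theorem) (auto intro!: continuous_intros always_eventually)
qed

section \<open>Measurability of the nonvanishing event\<close>

text \<open>Compactness of \<open>{a..a + real n}\<close> gives a positive lower bound for each
  \<open>n\<close>; on the whole half-line the infimum may be 0. Conversely, near a zero there are
  rational offsets where \<open>f\<close> is too small.\<close>

lemma nonvanishing_iff_rational: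
  fixes f :: "real \<Rightarrow> real"
  assumes f: "continuous_on {a..} f"
  shows "(\<forall>\<sigma>\<ge>a. f \<sigma> \<noteq> 0) \<longleftrightarrow>
    (\<forall>n::nat. \<exists>k. \<forall>r::rat. 0 \<le> r \<and> r \<le> of_nat n \<longrightarrow> inverse (real (Suc k)) \<le> \<bar>f (a + of_rat r)\<bar>)"
proof safe
  fix n :: nat
  assume nz: "\<forall>\<sigma>\<ge>a. f \<sigma> \<noteq> 0"
  have "continuous_on {a..a + real n} (\<lambda>x. \<bar>f x\<bar>)"
    by (intro continuous_intros continuous_on_subset[OF f]) auto
  then obtain z where z: "z \<in> {a..a + real n}" "\<And>y. y \<in> {a..a + real n} \<Longrightarrow> \<bar>f z\<bar> \<le> \<bar>f y\<bar>"
    using continuous_attains_inf[of "{a..a + real n}" "\<lambda>x. \<bar>f x\<bar>"] by auto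
  obtain k where k: "inverse (real (Suc k)) < \<bar>f z\<bar>"
    using nz z(1) reals_Archimedean[of "\<bar>f z\<bar>"] by auto
  show "\<exists>k. \<forall>r::rat. 0 \<le> r \<and> r \<le> of_nat n \<longrightarrow> inverse (real (Suc k)) \<le> \<bar>f (a + of_rat r)\<bar>"
  proof (intro exI allI impI)
    fix r :: rat assume "0 \<le> r \<and> r \<le> of_nat n"
    then have "0 \<le> real_of_rat r" "real_of_rat r \<le> real_of_rat (of_nat n)"
      by (simp_all only: zero_le_of_rat_iff of_rat_less_eq)
    then have "a + of_rat r \<in> {a..a + real n}"
      by simp
    then show "inverse (real (Suc k)) \<le> \<bar>f (a + of_rat r)\<bar>"
      using k z(2) by fastforce
  qed
next
  fix \<sigma>
  assume lower: "\<forall>n::nat. \<exists>k. \<forall>r::rat. 0 \<le> r \<and> r \<le> of_nat n \<longrightarrow> inverse (real (Suc k)) \<le> \<bar>f (a + of_rat r)\<bar>"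
    and \<sigma>: "a \<le> \<sigma>" "f \<sigma> = 0"
  obtain n :: nat where n: "\<sigma> - a < real n"
    using reals_Archimedean2 by blast
  obtain k where k: "\<And>r::rat. 0 \<le> r \<Longrightarrow> r \<le> of_nat n \<Longrightarrow> inverse (real (Suc k)) \<le> \<bar>f (a + of_rat r)\<bar>"
    using lower by blast
  obtain d where d: "d > 0" "\<And>y. y \<ge> a \<Longrightarrow> dist y \<sigma> < d \<Longrightarrow> dist (f y) (f \<sigma>) < inverse (real (Suc k))"
    using f[unfolded continuous_on_iff, rule_format, of \<sigma> "inverse (real (Suc k))"] \<sigma>(1) by auto
  \<comment> \<open>Choosing the offset strictly above \<open>\<sigma> - a\<close> keeps the point
    in the domain even if \<sigma> equals \<open>a\<close>; the strict choice of \<open>n\<close>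
    leaves room for it.\<close>
  obtain r where r: "\<sigma> - a < of_rat r" "of_rat r < min (\<sigma> - a + d) (real n)"
    using of_rat_dense[of "\<sigma> - a" "min (\<sigma> - a + d) (real n)"] n d(1) by auto
  have "0 \<le> real_of_rat r" "real_of_rat r \<le> real_of_rat (of_nat n)"
    using r \<sigma>(1) unfolding of_rat_of_nat_eq by linarith+
  then have "0 \<le> r" "r \<le> of_nat n"
    by (simp_all only: zero_le_of_rat_iff of_rat_less_eq)
  then have "inverse (real (Suc k)) \<le> \<bar>f (a + of_rat r)\<bar>"
    by (rule k)
  moreover have "\<bar>f (a + of_rat r)\<bar> < inverse (real (Suc k))"
    using d(2)[of "a + of_rat r"] r \<sigma> \<open>0 \<le> r\<close> by (auto simp: dist_real_def)
  ultimately show False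
    by simp
qed

text \<open>Convergence at \<open>a\<close> propagates to the right, so one Cauchy condition covers
  all \<sigma>, and nonvanishing reduces to countably many conditions on measurable
  functions.\<close>

lemma sets_dirichlet_nonvanishing:
  fixes X :: "nat \<Rightarrow> 'a \<Rightarrow> real"
  assumes p: "strict_mono p" "\<And>n. 1 \<le> p n" and [measurable]: "\<And>n. X n \<in> borel_measurable M"
  shows "{\<omega> \<in> space M. \<forall>\<sigma>\<ge>a. dirichlet_converges p (\<lambda>n. X n \<omega>) \<sigma> \<and>
    dirichlet_series p (\<lambda>n. X n \<omega>) \<sigma> \<noteq> 0} \<in> sets M"
proof -
  have "(\<forall>\<sigma>\<ge>a. dirichlet_converges p x \<sigma> \<and> dirichlet_series p x \<sigma> \<noteq> 0) \<longleftrightarrow>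
    Cauchy (\<lambda>n. \<Sum>i<n. x i / p i powr a) \<and> (\<forall>n::nat. \<exists>k. \<forall>r::rat. 0 \<le> r \<and> r \<le> of_nat n \<longrightarrow>
      inverse (real (Suc k)) \<le> \<bar>\<Sum>i. x i / p i powr (a + of_rat r)\<bar>)" (is "?L \<longleftrightarrow> ?C \<and> ?R") for x
  proof (cases "dirichlet_converges p x a")
    case True
    then have "?C"
      by (simp add: dirichlet_converges_def summable_iff_convergent Cauchy_convergent_iff)
    moreover have "?L \<longleftrightarrow> (\<forall>\<sigma>\<ge>a. dirichlet_series p x \<sigma> \<noteq> 0)"
      using dirichlet_converges_mono[OF p True] by blast
    ultimately show ?thesis
      using nonvanishing_iff_rational[OF continuous_on_dirichlet_series[OF p True]]
      by (simp add: dirichlet_series_def)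
  next
    \<comment> \<open>Here the left side already fails at \<sigma> equal to \<open>a\<close>, so the
      values of the divergent sums on the right do not matter.\<close>
    case False
    then show ?thesis
      by (auto simp: dirichlet_converges_def summable_iff_convergent Cauchy_convergent_iff)
  qed
  then have "{\<omega> \<in> space M. \<forall>\<sigma>\<ge>a. dirichlet_converges p (\<lambda>n. X n \<omega>) \<sigma> \<and>
      dirichlet_series p (\<lambda>n. X n \<omega>) \<sigma> \<noteq> 0} =
    {\<omega> \<in> space M. Cauchy (\<lambda>n. \<Sum>i<n. X i \<omega> / p i powr a)} \<inter>
    {\<omega> \<in> space M. \<forall>n::nat. \<exists>k. \<forall>r::rat. 0 \<le> r \<and> r \<le> of_nat n \<longrightarrow>
      inverse (real (Suc k)) \<le> \<bar>\<Sum>i. X i \<omega> / p i powr (a + of_rat r)\<bar>}"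
    by (simp only: Int_def) blast
  also have "\<dots> \<in> sets M"
  proof (rule sets.Int)
    have [measurable]: "(\<lambda>\<omega>. \<Sum>i. X i \<omega> / p i powr b) \<in> borel_measurable M" for b
      by measurable
    show "{\<omega> \<in> space M. \<forall>n::nat. \<exists>k. \<forall>r::rat. 0 \<le> r \<and> r \<le> of_nat n \<longrightarrow>
      inverse (real (Suc k)) \<le> \<bar>\<Sum>i. X i \<omega> / p i powr (a + of_rat r)\<bar>} \<in> sets M"
      by (intro sets.sets_Collect_countable_All sets.sets_Collect_countable_Ex sets.sets_Collect_imp
          sets.sets_Collect_const borel_measurable_le) measurable
    show "{\<omega> \<in> space M. Cauchy (\<lambda>n. \<Sum>i<n. X i \<omega> / p i powr a)} \<in> sets M"
      by (intro sets_Collect_Cauchy borel_measurable_sum borel_measurable_divide) simp_all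
  qed
  finally show ?thesis .
qed

section \<open>The favourable event and the conclusion\<close>

lemma (in prob_space) rademacher_all_one:
  fixes X :: "nat \<Rightarrow> 'a \<Rightarrow> real"
  assumes ind: "indep_vars (\<lambda>_. borel) X UNIV"
    and plus: "\<And>n. prob {\<omega> \<in> space M. X n \<omega> = 1} = 1 / 2"
  shows "prob {\<omega> \<in> space M. \<forall>n<N. X n \<omega> = 1} = (1 / 2) ^ N"
proof (cases "N = 0")
  case False
  have "prob (\<Inter>n\<in>{..<N}. X n -` {1} \<inter> space M) = (\<Prod>n\<in>{..<N}. prob (X n -` {1} \<inter> space M))"
    using False by (intro indep_varsD[OF ind]) auto
  moreover have "(\<Inter>n\<in>{..<N}. X n -` {1} \<inter> space M) = {\<omega> \<in> space M. \<forall>n<N. X n \<omega> = 1}"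
    using False by auto
  ultimately show ?thesis
    using plus by (simp add: vimage_def Int_def conj_commute)
qed (simp add: prob_space)

text \<open>The tail at \<sigma> is at most \<open>e * p N powr (a - \<sigma>)\<close>. Since
  \<open>p 0\<close> is at most \<open>p N\<close> and the exponent is not positive, this is less
  than \<open>p 0 powr (- \<sigma>)\<close>, the first term of a head whose terms are all
  positive.\<close>

lemma dirichlet_series_pos:
  assumes p: "strict_mono p" "\<And>n. 1 \<le> p n" and conv: "dirichlet_converges p x a"
    and "N > 0" and head: "\<And>n. n < N \<Longrightarrow> x n = 1"
    and tail: "\<And>j. \<bar>\<Sum>i<j. x (N + i) / p (N + i) powr a\<bar> \<le> e" and e: "e < 1 / p 0 powr a"
    and "a \<le> \<sigma>"
  shows "dirichlet_series p x \<sigma> > 0"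
proof -
  let ?f = "\<lambda>i. x i / p i powr \<sigma>"
  have pos: "0 < p n" for n
    using p(2)[of n] by linarith
  have summ: "summable ?f"
    using dirichlet_converges_mono[OF p conv \<open>a \<le> \<sigma>\<close>] by (simp add: dirichlet_converges_def)
  have "\<bar>\<Sum>i. ?f (N + i)\<bar> \<le> e * p N powr (a - \<sigma>)"
  proof (rule LIMSEQ_le_const2)
    have "summable (\<lambda>i. ?f (N + i))"
      using summ summable_iff_shift[of ?f N] by (simp add: add.commute)
    then show "(\<lambda>m. \<bar>\<Sum>i<m. ?f (N + i)\<bar>) \<longlonglongrightarrow> \<bar>\<Sum>i. ?f (N + i)\<bar>"
      by (intro tendsto_rabs summable_LIMSEQ)
    show "\<exists>m. \<forall>n\<ge>m. \<bar>\<Sum>i<n. ?f (N + i)\<bar> \<le> e * p N powr (a - \<sigma>)"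
      using dirichlet_block_bound[OF p(1) pos \<open>a \<le> \<sigma>\<close> tail] by blast
  qed
  also have "\<dots> < 1 / p 0 powr a * p N powr (a - \<sigma>)"
    using e pos[of N] by (intro mult_strict_right_mono) auto
  also have "\<dots> \<le> 1 / p 0 powr a * p 0 powr (a - \<sigma>)"
    using \<open>a \<le> \<sigma>\<close> pos[of 0] strict_mono_leD[OF p(1), of 0 N]
    by (intro mult_left_mono powr_mono2') auto
  also have "\<dots> = ?f 0"
    using pos[of 0] head[OF \<open>N > 0\<close>] by (simp add: powr_diff)
  also have "\<dots> \<le> (\<Sum>i<N. ?f i)"
    using head \<open>N > 0\<close> by (intro member_le_sum) auto
  finally have "\<bar>\<Sum>i. ?f (N + i)\<bar> < (\<Sum>i<N. ?f i)" .
  moreover have "dirichlet_series p x \<sigma> = (\<Sum>i. ?f (N + i)) + (\<Sum>i<N. ?f i)"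
    unfolding dirichlet_series_def using suminf_split_initial_segment[OF summ, of N]
    by (simp add: add.commute)
  ultimately show ?thesis
    by linarith
qed

theorem mainTheorem2:
  fixes M :: "'a measure"
    and p :: "nat \<Rightarrow> real"
    and X :: "nat \<Rightarrow> 'a \<Rightarrow> real"
    and \<delta> :: real
  assumes "prob_space M"
    and "strict_mono p"
    and "\<And>n. p n > 0"
    and P1: "range p \<inter> {0..<1} = {}"
    and P2: "has_abscissa p (\<lambda>_. 1) 1"
    and "prob_space.indep_vars M (\<lambda>_. borel) X UNIV"
    and "\<And>n. measure M {\<omega> \<in> space M. X n \<omega> = 1} = 1 / 2"
    and "\<And>n. measure M {\<omega> \<in> space M. X n \<omega> = - 1} = 1 / 2"
    and "(\<Sum>n. ennreal (1 / p n)) = \<infinity>"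
    and "\<delta> > 0"
  shows "measure M {\<omega> \<in> space M. \<forall>\<sigma>\<ge>1/2 + \<delta>.
           dirichlet_converges p (\<lambda>n. X n \<omega>) \<sigma> \<and>
           dirichlet_series p (\<lambda>n. X n \<omega>) \<sigma> \<noteq> 0} > 0"
proof -
  interpret prob_space M by fact
  note ind = assms(6) and plus = assms(7) and minus = assms(8)
  have [measurable]: "X n \<in> borel_measurable M" for n
    using ind by (simp add: indep_vars_def)
  have p1: "1 \<le> p n" for n
  proof (rule ccontr)
    assume "\<not> 1 \<le> p n"
    then have "p n \<in> range p \<inter> {0..<1}"
      using assms(3)[of n] by auto
    then show False
      using P1 by blast
  qed
  define a where "a = 1/2 + \<delta>"
  define c where "c i = 1 / p i powr a" for i
  \<comment> \<open>The exponent \<open>2 * a\<close> is \<open>1 + 2 * \<delta>\<close>, beyond the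
    abscissa, so the variances of the terms at \<open>a\<close> are summable.\<close>
  have "dirichlet_converges p (\<lambda>_. 1) (2 * a)"
    using P2 \<open>\<delta> > 0\<close> unfolding has_abscissa_def a_def by simp
  moreover have "(c i)\<^sup>2 = 1 / p i powr (2 * a)" for i
    by (simp add: c_def power2_eq_square powr_add[symmetric])
  ultimately have summ: "summable (\<lambda>i. (c i)\<^sup>2)"
    by (simp add: dirichlet_converges_def)
  define t where "t = c 0 / 2"
  have "c 0 > 0"
    using p1[of 0] by (simp add: c_def)
  then have "t > 0" "t < c 0"
    by (simp_all add: t_def)
  then have t: "t > 0" "t < 1 / p 0 powr a"
    by (simp_all add: c_def)
  obtain K where K: "\<And>n. n \<ge> K \<Longrightarrow> norm (\<Sum>i. (c (i + n))\<^sup>2) < t\<^sup>2"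
    using suminf_exist_split[OF _ summ, of "t\<^sup>2"] t(1) by auto
  \<comment> \<open>The successor ensures that the head contains the first term.\<close>
  define N where "N = Suc K"
  have N: "N > 0" "(\<Sum>i. (c (N + i))\<^sup>2) / t\<^sup>2 < 1"
    using K[of N] t(1) by (simp_all add: N_def add.commute)

  let ?S = "\<lambda>f j. \<bar>\<Sum>i<j. c (N + i) * f (N + i)\<bar>"
  \<comment> \<open>As predicates of a sequence, \<open>?H\<close> and \<open>?T\<close> apply both
    to all signs and to their restrictions to the two blocks.\<close>
  let ?H = "\<lambda>f. \<forall>n\<in>{..<N}. f n = (1::real)" and ?T = "\<lambda>f. \<not> (\<exists>j. t \<le> ?S f j)"
  let ?G = "{\<omega> \<in> space M. ?H (\<lambda>i. X i \<omega>) \<and> ?T (\<lambda>i. X i \<omega>)}"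
  have "prob {\<omega> \<in> space M. ?H (restrict (\<lambda>i. X i \<omega>) {..<N}) \<and> ?T (restrict (\<lambda>i. X i \<omega>) {N..})} =
    prob {\<omega> \<in> space M. ?H (restrict (\<lambda>i. X i \<omega>) {..<N})} * prob {\<omega> \<in> space M. ?T (restrict (\<lambda>i. X i \<omega>) {N..})}"
    by (intro prob_indep_restrict[OF ind]) (auto, measurable)
  then have "prob ?G = prob {\<omega> \<in> space M. ?H (\<lambda>i. X i \<omega>)} * prob {\<omega> \<in> space M. ?T (\<lambda>i. X i \<omega>)}"
    by simp
  also have "prob {\<omega> \<in> space M. ?H (\<lambda>i. X i \<omega>)} = (1 / 2) ^ N"
    using rademacher_all_one[OF ind plus, of N] by (simp add: Ball_def)
  also have "prob {\<omega> \<in> space M. ?T (\<lambda>i. X i \<omega>)} = 1 - prob {\<omega> \<in> space M. \<exists>j. t \<le> ?S (\<lambda>i. X i \<omega>) j}"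
    by (intro prob_neg) measurable
  finally have "prob ?G > 0"
    using rademacher_maximal[OF ind plus minus t(1) summ, of N] N(2) by simp
  also have "prob ?G \<le> prob {\<omega> \<in> space M. \<forall>\<sigma>\<ge>a. dirichlet_converges p (\<lambda>n. X n \<omega>) \<sigma> \<and>
      dirichlet_series p (\<lambda>n. X n \<omega>) \<sigma> \<noteq> 0}"
  \<comment> \<open>The inclusion holds only almost everywhere, since the bounded tail sums in
    \<open>?G\<close> do not force convergence at \<open>a\<close>.\<close>
  proof (rule finite_measure_mono_AE)
    show "AE \<omega> in M. \<omega> \<in> ?G \<longrightarrow> \<omega> \<in> {\<omega> \<in> space M. \<forall>\<sigma>\<ge>a. dirichlet_converges p (\<lambda>n. X n \<omega>) \<sigma> \<and>
      dirichlet_series p (\<lambda>n. X n \<omega>) \<sigma> \<noteq> 0}"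
      using rademacher_AE_summable[OF ind plus minus summ]
    proof eventually_elim
      case (elim \<omega>)
      then have conv: "dirichlet_converges p (\<lambda>n. X n \<omega>) a"
        by (simp add: dirichlet_converges_def c_def)
      show ?case
      proof (intro impI CollectI conjI allI)
        assume G: "\<omega> \<in> ?G"
        then show "\<omega> \<in> space M"
          by simp
        fix \<sigma> assume \<sigma>: "a \<le> \<sigma>"
        show "dirichlet_converges p (\<lambda>n. X n \<omega>) \<sigma>"
          by (rule dirichlet_converges_mono[OF assms(2) p1 conv \<sigma>])
        have "dirichlet_series p (\<lambda>n. X n \<omega>) \<sigma> > 0"
          using G by (intro dirichlet_series_pos[OF assms(2) p1 conv N(1) _ _ t(2) \<sigma>])
            (auto simp: c_def not_le less_imp_le)
        then show "dirichlet_series p (\<lambda>n. X n \<omega>) \<sigma> \<noteq> 0"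
          by simp
      qed
    qed
    show "{\<omega> \<in> space M. \<forall>\<sigma>\<ge>a. dirichlet_converges p (\<lambda>n. X n \<omega>) \<sigma> \<and>
      dirichlet_series p (\<lambda>n. X n \<omega>) \<sigma> \<noteq> 0} \<in> events"
      by (rule sets_dirichlet_nonvanishing[OF assms(2) p1]) measurable
  qed
  finally show ?thesis
    unfolding a_def .
qed

end
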